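(* For every integer $k\geq 6$ there exists a (finite, simple, connected) graph $G$ such that $\gamma_{\rm wcon}(G)-\gamma_c(G)=k$.
   Context: All graphs are finite, undirected, simple and connected. A set $D\subseteq V(G)$ is dominating if every vertex of $V(G)-D$ has a neighbour in $D$. $D$ is a connected dominating set if it is dominating and $G[D]$ is connected; $\gamma_c(G)$ is the minimum cardinality of a connected dominating set. A set $X$ is weakly convex if for any two vertices $a,b\in X$ there is a shortest $(a-b)$-path in $G$ (an $(a-b)$-geodesic) all of whose vertices lie in $X$. $\gamma_{\rm wcon}(G)$ is the minimum cardinality of a set that is both weakly convex and dominating. *)

theory Defs
  imports
    "Graph_Theory.Digraph_Component"
    "Graph_Theory.Vertex_Walk"
begin

text \<open>
  Following \<^verbatim>\<open>Graph_Theory\<close>, a finite simple undirected graph is a finite symmetric digraph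
  without loops and parallel arcs, i.e. an instance of \<^locale>\<open>graph\<close>.  The predicate
  \<^const>\<open>connected\<close> of that library requires at least one vertex.
\<close>

definition dominating :: "('a, 'b) pre_digraph \<Rightarrow> 'a set \<Rightarrow> bool" where
  "dominating G D \<longleftrightarrow> D \<subseteq> verts G \<and> (\<forall>v \<in> verts G - D. \<exists>u \<in> D. v \<rightarrow>\<^bsub>G\<^esub> u)"

definition connected_dominating :: "('a, 'b) pre_digraph \<Rightarrow> 'a set \<Rightarrow> bool" where
  "connected_dominating G D \<longleftrightarrow> dominating G D \<and> connected (G \<restriction> D)"

definition geodesic :: "('a, 'b) pre_digraph \<Rightarrow> 'a \<Rightarrow> 'a vwalk \<Rightarrow> 'a \<Rightarrow> bool" where
  "geodesic G a p b \<longleftrightarrow> vpath p G \<and> hd p = a \<and> last p = b \<and>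
     (\<forall>q. vpath q G \<and> hd q = a \<and> last q = b \<longrightarrow> vwalk_length p \<le> vwalk_length q)"

definition weakly_convex :: "('a, 'b) pre_digraph \<Rightarrow> 'a set \<Rightarrow> bool" where
  "weakly_convex G X \<longleftrightarrow> X \<subseteq> verts G \<and>
     (\<forall>a \<in> X. \<forall>b \<in> X. \<exists>p. geodesic G a p b \<and> set p \<subseteq> X)"

text \<open>
  For a finite connected graph the vertex set itself qualifies in both definitions below,
  so the minima are attained.
\<close>

definition gamma_c :: "('a, 'b) pre_digraph \<Rightarrow> nat" where
  "gamma_c G = (LEAST n. \<exists>D. connected_dominating G D \<and> card D = n)"

definition gamma_wcon :: "('a, 'b) pre_digraph \<Rightarrow> nat" where
  "gamma_wcon G = (LEAST n. \<exists>D. weakly_convex G D \<and> dominating G D \<and> card D = n)"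

end

theory Submission
  imports Defs
begin

text \<open>
  Take vertices \<open>c, y, x\<close> and \<open>u\<^sub>1, \<dots>, u\<^sub>k\<close>, the path \<open>c y x\<close> and all edges \<open>x u\<^sub>i\<close>, attach a
  pendant leaf to each of these \<open>k + 3\<close> vertices, and add vertices \<open>w\<^sub>i\<close> adjacent exactly to \<open>u\<^sub>i\<close>
  and \<open>c\<close>.  The \<open>k + 3\<close> support vertices form a connected dominating set, and the leaves
  force any dominating set to be at least that large.  A weakly convex dominating set
  contains all support vertices and hence every \<open>w\<^sub>i\<close>, the middle of the only geodesic from
  \<open>u\<^sub>i\<close> to \<open>c\<close>.  Conversely the set of all non-leaves is weakly convex, since a geodesic never
  passes through a leaf; its size is \<open>2 k + 3\<close>.
\<close>

section \<open>Connectivity and geodesics in symmetric digraphs\<close>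

text \<open>Reachability is symmetric here, so any two vertices are joined by way of
  \<open>r\<close>.\<close>

lemma (in sym_digraph) connected_if_reaches_root:
  assumes "r \<in> verts G" "\<And>v. v \<in> verts G \<Longrightarrow> v \<rightarrow>\<^sup>* r"
  shows "connected G"
proof -
  have "u \<rightarrow>\<^sup>* v" if "u \<in> verts G" "v \<in> verts G" for u v
    using assms(2)[OF that(1)] symmetric_reachable'[OF assms(2)[OF that(2)]] by (rule reachable_trans)
  then show ?thesis
    using assms(1) unfolding connected_def
    by (auto intro!: strongly_connectedI simp: reachable_mk_symmetric_eq[OF sym_arcs])
qed

lemma (in sym_digraph) sym_digraph_induce_subgraph: "sym_digraph (G \<restriction> D)"
proof -
  interpret H: wf_digraph "G \<restriction> D" by (rule wellformed_induce_subgraph)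
  show ?thesis
    using sym_arcs by unfold_locales (fastforce simp: symmetric_conv)
qed

lemma vwalk_stepD:
  assumes "vwalk (xs @ a # b # ys) G"
  shows "a \<rightarrow>\<^bsub>G\<^esub> b"
proof -
  have "vwalk (a # b # ys) G"
    using assms by (rule vwalkI_append_r[rotated]) simp
  then show ?thesis
    by (auto simp: vwalk_def)
qed

lemma (in sym_digraph) geodesic_exists:
  assumes "connected G" "a \<in> verts G" "b \<in> verts G"
  shows "\<exists>p. geodesic G a p b"
proof -
  have "a \<rightarrow>\<^sup>* b"
    using assms unfolding connected_def
    by (auto elim!: strongly_connectedE simp: reachable_mk_symmetric_eq[OF sym_arcs])
  then obtain p where "vpath p G \<and> hd p = a \<and> last p = b"
    by (auto simp: reachable_vpath_conv)
  then show ?thesis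
    using arg_min_nat_lemma[of "\<lambda>p. vpath p G \<and> hd p = a \<and> last p = b" p vwalk_length]
    unfolding geodesic_def by blast
qed

section \<open>Weak convexity in the presence of leaves and short distances\<close>

text \<open>An inner vertex of a path has two distinct neighbours on it, so a path between points of
  \<open>X\<close> cannot visit a vertex with at most one neighbour. Hence any geodesic between them
  serves.\<close>

lemma (in sym_digraph) weakly_convex_if_complement_leaves:
  assumes "connected G" "X \<subseteq> verts G"
    and leaves: "\<And>l u v. l \<in> verts G - X \<Longrightarrow> l \<rightarrow> u \<Longrightarrow> l \<rightarrow> v \<Longrightarrow> u = v"
  shows "weakly_convex G X"
  unfolding weakly_convex_def
proof (intro conjI ballI)
  fix a b assume ab: "a \<in> X" "b \<in> X"
  then obtain p where p: "geodesic G a p b"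
    using geodesic_exists assms by blast
  then have walk: "vwalk p G" and dist: "distinct p" and ends: "hd p = a" "last p = b"
    by (auto simp: geodesic_def)
  have "l \<in> X" if "l \<in> set p" for l
  proof (rule ccontr)
    assume "l \<notin> X"
    obtain xs ys where split: "p = xs @ l # ys"
      using \<open>l \<in> set p\<close> by (auto dest: split_list)
    \<comment> \<open>Both ends of \<open>p\<close> lie in \<open>X\<close>, so \<open>l\<close> is
      an inner vertex.\<close>
    with \<open>l \<notin> X\<close> ends ab have "xs \<noteq> []" "ys \<noteq> []"
      by (auto split: if_splits)
    then obtain xs' u v ys' where p_eq: "p = xs' @ u # l # v # ys'"
      using split by (cases xs rule: rev_cases; cases ys) auto
    have "u \<rightarrow> l" "l \<rightarrow> v"
      using walk vwalk_stepD[of xs' u l "v # ys'"] vwalk_stepD[of "xs' @ [u]" l v ys']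
      by (auto simp: p_eq)
    moreover have "l \<in> verts G" using walk \<open>l \<in> set p\<close> by auto
    ultimately have "u = v"
      using leaves \<open>l \<notin> X\<close> by (auto dest: arcs_ends_symmetric[OF sym_arcs])
    then show False using dist by (simp add: p_eq)
  qed
  then show "\<exists>p. geodesic G a p b \<and> set p \<subseteq> X" using p by blast
qed fact

text \<open>A geodesic that leaves \<open>l\<close> for a different vertex can only make its first
  step to \<open>s\<close>.\<close>

lemma weakly_convex_neighbour_of_leaf:
  assumes "weakly_convex G X" "l \<in> X" "b \<in> X" "b \<noteq> l"
    and "\<And>v. l \<rightarrow>\<^bsub>G\<^esub> v \<Longrightarrow> v = s"
  shows "s \<in> X"
proof -
  obtain p where p: "geodesic G l p b" "set p \<subseteq> X"
    using assms unfolding weakly_convex_def by blast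
  then obtain q where "p = l # q"
    by (cases p) (auto simp: geodesic_def vpath_def vwalk_def)
  with p \<open>b \<noteq> l\<close> obtain v r where eq: "p = l # v # r"
    by (cases q) (auto simp: geodesic_def)
  with p(1) have "l \<rightarrow>\<^bsub>G\<^esub> v"
    using vwalk_stepD[of "[]" l v r] by (auto simp: geodesic_def)
  then show ?thesis using assms(5) p(2) eq by auto
qed

text \<open>The vertices \<open>a\<close> and \<open>b\<close> are at distance exactly 2, so the
  inner vertex of any geodesic between them is a common neighbour.\<close>

lemma (in sym_digraph) weakly_convex_unique_common_neighbour:
  assumes "weakly_convex G X" "a \<in> X" "b \<in> X" "a \<noteq> b" "\<not> a \<rightarrow> b"
    and m: "a \<rightarrow> m" "m \<rightarrow> b" "m \<noteq> a" "m \<noteq> b"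
    and uniq: "\<And>v. a \<rightarrow> v \<Longrightarrow> v \<rightarrow> b \<Longrightarrow> v = m"
  shows "m \<in> X"
proof -
  obtain p where p: "geodesic G a p b" "set p \<subseteq> X"
    using assms unfolding weakly_convex_def by blast
  have "vpath [a, m, b] G"
    using m \<open>a \<noteq> b\<close> by (auto simp: vpath_def intro: adj_in_verts)
  \<comment> \<open>\<open>vwalk_length\<close> counts edges: two edges amount to three list
    entries.\<close>
  then have len: "length p \<le> 3"
    using p(1) unfolding geodesic_def by (auto dest!: spec[of _ "[a, m, b]"])
  have walk: "vwalk p G" "hd p = a" "last p = b"
    using p(1) by (auto simp: geodesic_def)
  then obtain v q where eq: "p = a # v # q"
    using \<open>a \<noteq> b\<close> by (cases p rule: vwalk_arcs.cases) auto
  then have "q \<noteq> []" using walk \<open>\<not> a \<rightarrow> b\<close> by auto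
  then have "q = [b]" using len walk(3) eq by (cases q) auto
  with walk eq have "v = m" by (intro uniq) auto
  then show ?thesis using p(2) eq by auto
qed

section \<open>The graph and its adjacencies\<close>

text \<open>
  Vertex \<open>3 * j\<close> is the \<open>j\<close>th support vertex (in the order \<open>c, y, x, u\<^sub>1, \<dots>, u\<^sub>k\<close>) and \<open>3 * j + 1\<close> its
  leaf; for \<open>j \<ge> 3\<close> vertex \<open>3 * j + 2\<close> is the shortcut between \<open>3 * j\<close> and \<open>c = 0\<close>.
\<close>

definition shortcut_edges :: "nat \<Rightarrow> (nat \<times> nat) set" where
  "shortcut_edges k = {(0, 3), (3, 6)} \<union> (\<lambda>j. (3 * j, 3 * j + 1)) ` {..<k + 3} \<union>
     (\<Union>j\<in>{3..<k + 3}. {(6, 3 * j), (3 * j, 3 * j + 2), (0, 3 * j + 2)})"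

definition supports :: "nat \<Rightarrow> nat set" where
  "supports k = (\<lambda>j. 3 * j) ` {..<k + 3}"

definition leaves :: "nat \<Rightarrow> nat set" where
  "leaves k = (\<lambda>j. 3 * j + 1) ` {..<k + 3}"

definition shortcuts :: "nat \<Rightarrow> nat set" where
  "shortcuts k = (\<lambda>j. 3 * j + 2) ` {3..<k + 3}"

text \<open>\<open>shortcut_edges\<close> lists each edge in one orientation, and the converse makes
  the digraph symmetric. Arcs are their own pairs of ends, which excludes parallel arcs.\<close>

definition shortcut_graph :: "nat \<Rightarrow> (nat, nat \<times> nat) pre_digraph" where
  "shortcut_graph k = \<lparr> verts = supports k \<union> leaves k \<union> shortcuts k,
     arcs = shortcut_edges k \<union> (shortcut_edges k)\<inverse>, tail = fst, head = snd \<rparr>"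

lemma shortcut_graph_simps:
  "verts (shortcut_graph k) = supports k \<union> leaves k \<union> shortcuts k"
  "u \<rightarrow>\<^bsub>shortcut_graph k\<^esub> v \<longleftrightarrow> (u, v) \<in> shortcut_edges k \<or> (v, u) \<in> shortcut_edges k"
  by (auto simp: shortcut_graph_def arcs_ends_conv)

lemma shortcut_edgesE:
  assumes "(u, v) \<in> shortcut_edges k"
  obtains "u = 0" "v = 3" | "u = 3" "v = 6"
  | j where "j < k + 3" "u = 3 * j" "v = 3 * j + 1"
  | j where "3 \<le> j" "j < k + 3" "u = 6" "v = 3 * j"
  | j where "3 \<le> j" "j < k + 3" "u = 3 * j" "v = 3 * j + 2"
  | j where "3 \<le> j" "j < k + 3" "u = 0" "v = 3 * j + 2"
  using assms unfolding shortcut_edges_def by auto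

lemma shortcut_edgesI:
  "(0, 3) \<in> shortcut_edges k" "(3, 6) \<in> shortcut_edges k"
  "j < k + 3 \<Longrightarrow> (3 * j, 3 * j + 1) \<in> shortcut_edges k"
  "3 \<le> j \<Longrightarrow> j < k + 3 \<Longrightarrow> (6, 3 * j) \<in> shortcut_edges k"
  "3 \<le> j \<Longrightarrow> j < k + 3 \<Longrightarrow> (3 * j, 3 * j + 2) \<in> shortcut_edges k"
  "3 \<le> j \<Longrightarrow> j < k + 3 \<Longrightarrow> (0, 3 * j + 2) \<in> shortcut_edges k"
  unfolding shortcut_edges_def by auto

lemma vertexI:
  "j < k + 3 \<Longrightarrow> 3 * j \<in> supports k"
  "j < k + 3 \<Longrightarrow> 3 * j + 1 \<in> leaves k"
  "3 \<le> j \<Longrightarrow> j < k + 3 \<Longrightarrow> 3 * j + 2 \<in> shortcuts k"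
  "0 \<in> supports k" "3 \<in> supports k" "6 \<in> supports k"
  unfolding supports_def leaves_def shortcuts_def by (auto simp: image_iff)+

lemma graph_shortcut_graph: "graph (shortcut_graph k)"
proof -
  have ends: "u \<in> verts (shortcut_graph k) \<and> v \<in> verts (shortcut_graph k) \<and> u \<noteq> v"
    if "(u, v) \<in> shortcut_edges k" for u v
    using that unfolding shortcut_graph_simps(1)
    by (cases rule: shortcut_edgesE) (auto simp: vertexI[simplified])
  have fin: "finite (shortcut_edges k)"
    by (simp add: shortcut_edges_def)
  show ?thesis
  proof unfold_locales
    fix e assume "e \<in> arcs (shortcut_graph k)"
    then obtain u v where "e = (u, v)" "(u, v) \<in> shortcut_edges k \<or> (v, u) \<in> shortcut_edges k"
      by (cases e) (auto simp: shortcut_graph_def)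
    moreover have "tail (shortcut_graph k) = fst" "head (shortcut_graph k) = snd"
      by (simp_all add: shortcut_graph_def)
    ultimately show "tail (shortcut_graph k) e \<in> verts (shortcut_graph k)"
      "head (shortcut_graph k) e \<in> verts (shortcut_graph k)"
      "tail (shortcut_graph k) e \<noteq> head (shortcut_graph k) e"
      using ends by (auto dest: ends)
  next
    show "finite (verts (shortcut_graph k))"
      by (simp add: shortcut_graph_simps supports_def leaves_def shortcuts_def)
    show "finite (arcs (shortcut_graph k))"
      using fin by (simp add: shortcut_graph_def)
    show "symmetric (shortcut_graph k)"
      by (auto simp: symmetric_def sym_def shortcut_graph_simps)
  qed (auto simp: shortcut_graph_def arc_to_ends_def)
qed

lemma leaf_neighbour:
  assumes "(3 * j + 1) \<rightarrow>\<^bsub>shortcut_graph k\<^esub> v"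
  shows "v = 3 * j"
proof -
  have arith: "3 * j + 1 \<noteq> 3 * i" "3 * j + 1 \<noteq> 3 * i + 2" for i :: nat
    by presburger+
  show ?thesis
    \<comment> \<open>The three instances separate the leaf from the literal vertices 0, 3 and 6,
      which \<open>shortcut_edges\<close> does not write as multiples.\<close>
    using assms arith(1)[of 0] arith(1)[of 1] arith(1)[of 2] arith
    by (auto simp: shortcut_graph_simps elim!: shortcut_edgesE)
qed

text \<open>The alternative for \<open>H\<close> lets one argument serve the connectivity of the
  whole graph and that of the subgraph induced by the supports. The root 6 is the vertex
  \<open>x\<close>.\<close>

lemma supports_reach_root:
  assumes "H = shortcut_graph k \<or> H = shortcut_graph k \<restriction> supports k" "v \<in> supports k"
  shows "v \<rightarrow>\<^sup>*\<^bsub>H\<^esub> 6"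
proof -
  interpret G: graph "shortcut_graph k" by (rule graph_shortcut_graph)
  interpret H: wf_digraph H
    using assms(1) G.wellformed_induce_subgraph G.wf_digraph by auto
  have adj: "u \<rightarrow>\<^bsub>H\<^esub> v" if "u \<rightarrow>\<^bsub>shortcut_graph k\<^esub> v" "u \<in> supports k" "v \<in> supports k" for u v
    using assms(1) that by (force simp: arcs_ends_conv)
  have y: "3 \<rightarrow>\<^sup>*\<^bsub>H\<^esub> 6"
    by (intro H.reachable_adjI adj) (auto simp: shortcut_graph_simps vertexI shortcut_edgesI)
  have c: "0 \<rightarrow>\<^sup>*\<^bsub>H\<^esub> 6"
    by (rule H.adj_reachable_trans[OF adj y])
      (auto simp: shortcut_graph_simps vertexI shortcut_edgesI)
  \<comment> \<open>Reflexivity needs 6 to be a vertex of \<open>H\<close>, which \<open>y\<close>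
    provides for both choices of \<open>H\<close>.\<close>
  have x: "6 \<rightarrow>\<^sup>*\<^bsub>H\<^esub> 6"
    using y by (rule H.reachable_in_verts(2)[THEN H.reachable_refl])
  have u: "(3 * j) \<rightarrow>\<^sup>*\<^bsub>H\<^esub> 6" if "3 \<le> j" "j < k + 3" for j
    by (intro H.reachable_adjI adj)
      (use that in \<open>auto simp: shortcut_graph_simps vertexI shortcut_edgesI\<close>)
  obtain j where j: "j < k + 3" "v = 3 * j"
    using assms(2) by (auto simp: supports_def)
  consider "j = 0" | "j = 1" | "j = 2" | "3 \<le> j" by linarith
  then show ?thesis
    by cases (use c y x u j in auto)
qed

lemma connected_shortcut_graph: "connected (shortcut_graph k)"
proof -
  interpret G: graph "shortcut_graph k" by (rule graph_shortcut_graph)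
  note root = supports_reach_root[where H = "shortcut_graph k" and k = k, OF disjI1[OF refl]]
  show ?thesis
  proof (rule G.connected_if_reaches_root)
    fix v assume "v \<in> verts (shortcut_graph k)"
    then consider "v \<in> supports k" | j where "j < k + 3" "v = 3 * j + 1 \<or> (3 \<le> j \<and> v = 3 * j + 2)"
      by (auto simp: shortcut_graph_simps leaves_def shortcuts_def)
    then show "v \<rightarrow>\<^sup>*\<^bsub>shortcut_graph k\<^esub> 6"
    proof cases
      case 2
      then have "v \<rightarrow>\<^bsub>shortcut_graph k\<^esub> (3 * j)"
        unfolding shortcut_graph_simps using shortcut_edgesI(3,5) by blast
      then show ?thesis
        using root[OF vertexI(1)[OF 2(1)]] by (rule G.adj_reachable_trans)
    qed (rule root)
  qed (simp add: shortcut_graph_simps vertexI)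
qed

section \<open>Dominating sets and the connected domination number\<close>

text \<open>A leaf outside \<open>D\<close> can be dominated only by its support.\<close>

lemma dominating_leaf_or_support:
  assumes "dominating (shortcut_graph k) D" "j < k + 3"
  shows "3 * j \<in> D \<or> 3 * j + 1 \<in> D"
  using assms vertexI(2)[OF assms(2)] leaf_neighbour[where k = k]
  unfolding dominating_def shortcut_graph_simps(1) by blast

text \<open>Every leaf and every shortcut is adjacent to a support.\<close>

lemma dominating_if_supports_subset:
  assumes "supports k \<subseteq> D" "D \<subseteq> verts (shortcut_graph k)"
  shows "dominating (shortcut_graph k) D"
  unfolding dominating_def
proof (intro conjI ballI)
  fix v assume "v \<in> verts (shortcut_graph k) - D"
  then obtain j where j: "j < k + 3" "v = 3 * j + 1 \<or> (3 \<le> j \<and> v = 3 * j + 2)"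
    using assms(1) by (auto simp: shortcut_graph_simps leaves_def shortcuts_def)
  then have "v \<rightarrow>\<^bsub>shortcut_graph k\<^esub> (3 * j)"
    unfolding shortcut_graph_simps using shortcut_edgesI(3,5) by blast
  then show "\<exists>u\<in>D. v \<rightarrow>\<^bsub>shortcut_graph k\<^esub> u"
    using assms(1) vertexI(1)[OF j(1)] by blast
qed fact

lemma card_supports: "card (supports k) = k + 3"
  unfolding supports_def by (subst card_image) (auto simp: inj_on_def)

lemma gamma_c_shortcut_graph: "gamma_c (shortcut_graph k) = k + 3"
  unfolding gamma_c_def
proof (rule Least_equality)
  interpret G: graph "shortcut_graph k" by (rule graph_shortcut_graph)
  interpret H: sym_digraph "shortcut_graph k \<restriction> supports k"
    by (rule G.sym_digraph_induce_subgraph)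
  have "connected (shortcut_graph k \<restriction> supports k)"
    by (rule H.connected_if_reaches_root[where r = 6])
      (auto simp: vertexI intro: supports_reach_root)
  moreover have "dominating (shortcut_graph k) (supports k)"
    by (rule dominating_if_supports_subset) (auto simp: shortcut_graph_simps)
  ultimately show "\<exists>D. connected_dominating (shortcut_graph k) D \<and> card D = k + 3"
    using card_supports by (auto simp: connected_dominating_def)
next
  interpret G: graph "shortcut_graph k" by (rule graph_shortcut_graph)
  fix n assume "\<exists>D. connected_dominating (shortcut_graph k) D \<and> card D = n"
  then obtain D where D: "dominating (shortcut_graph k) D" "card D = n"
    by (auto simp: connected_dominating_def)
  then have fin: "finite D"
    using G.finite_verts by (auto simp: dominating_def intro: finite_subset)
  \<comment> \<open>Support and leaf number \<open>j\<close> both have quotient \<open>j\<close>, so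
    division by 3 maps \<open>D\<close> onto all \<open>k + 3\<close> indices.\<close>
  have "{..<k + 3} \<subseteq> (\<lambda>v. v div 3) ` D"
  proof
    fix j assume "j \<in> {..<k + 3}"
    then have "3 * j \<in> D \<or> 3 * j + 1 \<in> D"
      using dominating_leaf_or_support[OF D(1)] by blast
    then show "j \<in> (\<lambda>v. v div 3) ` D"
      by (auto intro: rev_image_eqI)
  qed
  then have "card {..<k + 3} \<le> card D"
    using fin by (rule surj_card_le[rotated])
  then show "k + 3 \<le> n" using D(2) by simp
qed

section \<open>The weakly convex domination number\<close>

text \<open>If \<open>X\<close> contains a leaf, a geodesic from it to some other vertex of
  \<open>X\<close> brings in its support.\<close>

lemma weakly_convex_dominating_supports:
  assumes "weakly_convex (shortcut_graph k) X" "dominating (shortcut_graph k) X"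
  shows "supports k \<subseteq> X"
proof
  fix s assume "s \<in> supports k"
  then obtain j where j: "j < k + 3" "s = 3 * j" by (auto simp: supports_def)
  \<comment> \<open>Domination at a second index \<open>i\<close> yields a vertex of
    \<open>X\<close> other than the leaf of \<open>j\<close>, the target of the geodesic.\<close>
  define i :: nat where "i = (if j = 0 then 1 else 0)"
  have "i < k + 3" "i \<noteq> j" by (auto simp: i_def)
  then obtain b where b: "b \<in> X" "b = 3 * i \<or> b = 3 * i + 1"
    using dominating_leaf_or_support[OF assms(2)] by blast
  then have "b \<noteq> 3 * j + 1" using \<open>i \<noteq> j\<close> by presburger
  then show "s \<in> X"
    using dominating_leaf_or_support[OF assms(2) j(1)] j(2) b(1)
      weakly_convex_neighbour_of_leaf[OF assms(1) _ b(1), of "3 * j + 1" "3 * j"] leaf_neighbour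
    by blast
qed

lemma weakly_convex_dominating_shortcuts:
  assumes "weakly_convex (shortcut_graph k) X" "dominating (shortcut_graph k) X"
  shows "shortcuts k \<subseteq> X"
proof
  interpret G: graph "shortcut_graph k" by (rule graph_shortcut_graph)
  fix w assume "w \<in> shortcuts k"
  then obtain j where j: "3 \<le> j" "j < k + 3" "w = 3 * j + 2" by (auto simp: shortcuts_def)
  \<comment> \<open>For the shortcuts next to 0 the residue is enough to tell them from the
    neighbours 6 and \<open>3 * j + 1\<close> of \<open>3 * j\<close>.\<close>
  have nbr0: "v = 3 \<or> v = 1 \<or> v mod 3 = 2" if "v \<rightarrow>\<^bsub>shortcut_graph k\<^esub> 0" for v
    using that unfolding shortcut_graph_simps
    by (auto elim!: shortcut_edgesE) presburger
  have nbru: "v = 6 \<or> v = 3 * j + 1 \<or> v = 3 * j + 2" if "(3 * j) \<rightarrow>\<^bsub>shortcut_graph k\<^esub> v" for v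
    using that[unfolded shortcut_graph_simps]
  proof
    assume "(3 * j, v) \<in> shortcut_edges k"
    then show ?thesis by (cases rule: shortcut_edgesE) (use j(1) in presburger)+
  next
    assume "(v, 3 * j) \<in> shortcut_edges k"
    then show ?thesis by (cases rule: shortcut_edgesE) (use j(1) in presburger)+
  qed
  have sup: "3 * j \<in> X" "0 \<in> X"
    using weakly_convex_dominating_supports[OF assms] vertexI(1)[OF j(2)] vertexI(4) by auto
  have not_adj: "\<not> (3 * j) \<rightarrow>\<^bsub>shortcut_graph k\<^esub> 0"
    using nbru[of 0] by auto
  have adj: "(3 * j) \<rightarrow>\<^bsub>shortcut_graph k\<^esub> w" "w \<rightarrow>\<^bsub>shortcut_graph k\<^esub> 0"
    using shortcut_edgesI(5,6)[OF j(1,2)] j(3) by (auto simp: shortcut_graph_simps)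
  \<comment> \<open>Neither 6 nor \<open>3 * j + 1\<close> fits \<open>nbr0\<close>, since
    \<open>j \<ge> 3\<close> keeps \<open>3 * j + 1\<close> away from 1.\<close>
  have uniq: "v = w" if "(3 * j) \<rightarrow>\<^bsub>shortcut_graph k\<^esub> v" "v \<rightarrow>\<^bsub>shortcut_graph k\<^esub> 0" for v
    using nbru[OF that(1)] nbr0[OF that(2)] j by presburger
  show "w \<in> X"
    by (rule G.weakly_convex_unique_common_neighbour[OF assms(1) sup _ not_adj adj _ _ uniq])
      (use j in auto)
qed

lemma card_supports_shortcuts: "card (supports k \<union> shortcuts k) = 2 * k + 3"
proof -
  have "card (shortcuts k) = k"
    unfolding shortcuts_def by (subst card_image) (auto simp: inj_on_def)
  moreover have "3 * i \<noteq> 3 * j + 2" for i j :: nat by presburger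
  then have "supports k \<inter> shortcuts k = {}"
    by (auto simp: supports_def shortcuts_def)
  ultimately show ?thesis
    using card_supports by (subst card_Un_disjoint) (auto simp: supports_def shortcuts_def)
qed

text \<open>The set \<open>supports k \<union> shortcuts k\<close> omits only leaves, so it
  qualifies, and it is contained in every weakly convex dominating set.\<close>

lemma gamma_wcon_shortcut_graph: "gamma_wcon (shortcut_graph k) = 2 * k + 3"
  unfolding gamma_wcon_def
proof (rule Least_equality)
  interpret G: graph "shortcut_graph k" by (rule graph_shortcut_graph)
  have "weakly_convex (shortcut_graph k) (supports k \<union> shortcuts k)"
  proof (rule G.weakly_convex_if_complement_leaves[OF connected_shortcut_graph])
    fix l u v
    assume "l \<in> verts (shortcut_graph k) - (supports k \<union> shortcuts k)"
    then obtain j where "l = 3 * j + 1"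
      by (auto simp: shortcut_graph_simps leaves_def)
    moreover assume "l \<rightarrow>\<^bsub>shortcut_graph k\<^esub> u" "l \<rightarrow>\<^bsub>shortcut_graph k\<^esub> v"
    ultimately show "u = v" using leaf_neighbour by blast
  qed (auto simp: shortcut_graph_simps)
  moreover have "dominating (shortcut_graph k) (supports k \<union> shortcuts k)"
    by (rule dominating_if_supports_subset) (auto simp: shortcut_graph_simps)
  ultimately show "\<exists>D. weakly_convex (shortcut_graph k) D \<and> dominating (shortcut_graph k) D \<and>
      card D = 2 * k + 3"
    using card_supports_shortcuts by blast
next
  interpret G: graph "shortcut_graph k" by (rule graph_shortcut_graph)
  fix n
  assume "\<exists>D. weakly_convex (shortcut_graph k) D \<and> dominating (shortcut_graph k) D \<and> card D = n"
  then obtain D where D: "weakly_convex (shortcut_graph k) D" "dominating (shortcut_graph k) D"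
    "card D = n" by blast
  then have "finite D"
    using G.finite_verts by (auto simp: dominating_def intro: finite_subset)
  then have "card (supports k \<union> shortcuts k) \<le> card D"
    using weakly_convex_dominating_supports[OF D(1,2)] weakly_convex_dominating_shortcuts[OF D(1,2)]
    by (intro card_mono) auto
  then show "2 * k + 3 \<le> n"
    using D(3) card_supports_shortcuts by simp
qed

theorem theorem2p1:
  fixes k :: int
  assumes "k \<ge> 6"
  shows "\<exists>G :: (nat, nat \<times> nat) pre_digraph. graph G \<and> connected G \<and>
           int (gamma_wcon G) - int (gamma_c G) = k"
proof (intro exI conjI)
  show "int (gamma_wcon (shortcut_graph (nat k))) - int (gamma_c (shortcut_graph (nat k))) = k"
    using assms by (simp add: gamma_wcon_shortcut_graph gamma_c_shortcut_graph)
qed (rule graph_shortcut_graph connected_shortcut_graph)+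

end
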